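(* Let $F\in C(\mathbb{T},\mathbb{R})$ and $G\in C_0(\mathbb{T},\mathbb{R})$. Then $$\left[J_\Delta\big(F\star \Delta G\big)\right]_N=-\left[J_\Delta\big((\nabla F)\star G\big)\right]_N,$$ $$\left[J_\nabla\big(F\star \nabla G\big)\right]_N=-\left[J_\nabla\big((\Delta F)\star G\big)\right]_N.$$
   Context: Let $a<b$ be real numbers, $N\ge 1$ an integer, $h=(b-a)/N$, $t_k=a+kh$ for $k=0,\dots,N$, $\mathbb{T}=\{t_0,\dots,t_N\}$, $\mathbb{T}_+=\{t_0,\dots,t_{N-1}\}$, $\mathbb{T}_-=\{t_1,\dots,t_N\}$. For a finite set $S$, $C(S,\mathbb{R})$ is the set of all functions $S\to\mathbb{R}$; write $F_k=F(t_k)$. $C_0(\mathbb{T},\mathbb{R})=\{G\in C(\mathbb{T},\mathbb{R}): G_0=G_N=0\}$. The product $\star$ is pointwise: $(F\star G)_k=F_kG_k$. $\Delta F\in C(\mathbb{T}_+,\mathbb{R})$, $(\Delta F)_k=(F_{k+1}-F_k)/h$ for $0\le k\le N-1$; $\nabla F\in C(\mathbb{T}_-,\mathbb{R})$, $(\nabla F)_k=(F_k-F_{k-1})/h$ for $1\le k\le N$. $(J_\Delta F)_k=\sum_{i=0}^{k-1}hF_i$ and $(J_\nabla F)_k=\sum_{i=1}^{k}hF_i$ for $0\le k\le N$ (empty sums are $0$); $[\,\cdot\,]_N$ denotes the value at $t_N$. Convention: since $G_0=G_N=0$, the product $(\nabla F)\star G$ is taken to be $0$ at $t_0$ and $(\Delta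 F)\star G$ is taken to be $0$ at $t_N$ (where $\nabla F$, resp. $\Delta F$, is not defined). *)

theory Defs
  imports Complex_Main "HOL-Library.FuncSet"
begin

definition step :: "real \<Rightarrow> real \<Rightarrow> nat \<Rightarrow> real" where
  "step a b N = (b - a) / real N"

definition node :: "real \<Rightarrow> real \<Rightarrow> nat \<Rightarrow> nat \<Rightarrow> real" where
  "node a b N k = a + real k * step a b N"

definition grid :: "real \<Rightarrow> real \<Rightarrow> nat \<Rightarrow> real set" where
  "grid a b N = node a b N ` {0..N}"

definition grid_plus :: "real \<Rightarrow> real \<Rightarrow> nat \<Rightarrow> real set" where
  "grid_plus a b N = node a b N ` {0..<N}"

definition grid_minus :: "real \<Rightarrow> real \<Rightarrow> nat \<Rightarrow> real set" where
  "grid_minus a b N = node a b N ` {1..N}"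

text \<open>
  For \<open>a < b\<close> and \<open>N \<ge> 1\<close> the nodes are pairwise distinct, so every grid point \<open>t\<close> is
  \<open>node a b N k\<close> for exactly one \<open>k \<le> N\<close>. The operators below, defined by formulas in the
  index \<open>k\<close>, recover it from the point by this inverse.
\<close>

definition node_index :: "real \<Rightarrow> real \<Rightarrow> nat \<Rightarrow> real \<Rightarrow> nat" where
  "node_index a b N = inv_into {0..N} (node a b N)"

text \<open>
  A function on a set \<open>S\<close> is represented by a total function that is \<open>undefined\<close> outside \<open>S\<close>.
\<close>

definition funs_on :: "real set \<Rightarrow> (real \<Rightarrow> real) set" where
  "funs_on S = S \<rightarrow>\<^sub>E UNIV"

definition funs0_on_grid :: "real \<Rightarrow> real \<Rightarrow> nat \<Rightarrow> (real \<Rightarrow> real) set" where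
  "funs0_on_grid a b N =
     {G \<in> funs_on (grid a b N). G (node a b N 0) = 0 \<and> G (node a b N N) = 0}"

definition forward_diff :: "real \<Rightarrow> real \<Rightarrow> nat \<Rightarrow> (real \<Rightarrow> real) \<Rightarrow> (real \<Rightarrow> real)" where
  "forward_diff a b N F =
     (\<lambda>t \<in> grid_plus a b N. let k = node_index a b N t in
        (F (node a b N (k + 1)) - F (node a b N k)) / step a b N)"

definition backward_diff :: "real \<Rightarrow> real \<Rightarrow> nat \<Rightarrow> (real \<Rightarrow> real) \<Rightarrow> (real \<Rightarrow> real)" where
  "backward_diff a b N F =
     (\<lambda>t \<in> grid_minus a b N. let k = node_index a b N t in
        (F (node a b N k) - F (node a b N (k - 1))) / step a b N)"

definition forward_integral :: "real \<Rightarrow> real \<Rightarrow> nat \<Rightarrow> (real \<Rightarrow> real) \<Rightarrow> (real \<Rightarrow> real)" where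
  "forward_integral a b N F =
     (\<lambda>t \<in> grid a b N. \<Sum>i = 0..<node_index a b N t. step a b N * F (node a b N i))"

definition backward_integral :: "real \<Rightarrow> real \<Rightarrow> nat \<Rightarrow> (real \<Rightarrow> real) \<Rightarrow> (real \<Rightarrow> real)" where
  "backward_integral a b N F =
     (\<lambda>t \<in> grid a b N. \<Sum>i = 1..node_index a b N t. step a b N * F (node a b N i))"

text \<open>The pointwise product on \<open>S\<close>; it is meant for factors that are both defined on \<open>S\<close>.\<close>

definition star_on :: "real set \<Rightarrow> (real \<Rightarrow> real) \<Rightarrow> (real \<Rightarrow> real) \<Rightarrow> (real \<Rightarrow> real)" where
  "star_on S F G = (\<lambda>t \<in> S. F t * G t)"

text \<open>
  The product of a function \<open>F\<close> on \<open>D \<subseteq> S\<close> with a function \<open>G\<close> on \<open>S\<close>, as a function on \<open>S\<close>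
  that is \<open>0\<close> where \<open>F\<close> is not defined. It is used when \<open>G\<close> vanishes on \<open>S - D\<close>: for a
  difference quotient \<open>F\<close>, \<open>S - D\<close> consists of one endpoint of the grid.
\<close>

definition star_zero_ext ::
  "real set \<Rightarrow> real set \<Rightarrow> (real \<Rightarrow> real) \<Rightarrow> (real \<Rightarrow> real) \<Rightarrow> (real \<Rightarrow> real)" where
  "star_zero_ext D S F G = (\<lambda>t \<in> S. if t \<in> D then F t * G t else 0)"

end

theory Submission
  imports Defs
begin

text \<open>
  Both identities are discrete integration by parts. With \<open>f i\<close> and \<open>g i\<close> the values at the
  \<open>i\<close>-th node, the product rule
  \[ f_{i+1} g_{i+1} - f_i g_i = f_i (g_{i+1} - g_i) + (f_{i+1} - f_i) g_{i+1} \]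
  telescopes (lemma \<open>summation_by_parts\<close>), and the boundary term vanishes because \<open>g\<close> is zero at
  both ends. The first identity is this formula for \<open>(f, g)\<close>, the second is the same formula for
  \<open>(g, f)\<close>.

  In the formula the two sums run over \<open>{0..<N}\<close> and \<open>{1..N}\<close>, whereas in each identity both
  integrals run over the same index set. The mismatch is one term at either end of the grid, and
  each such term has \<open>g\<close> at an endpoint as a factor or is zero by the extension convention.
  What remains is bookkeeping: the nodes are distinct, so the operators can be
  computed at a node in terms of its index, and the step in front of each summand cancels
  the denominator of the difference quotient.
\<close>

lemma summation_by_parts:
  fixes f g :: "nat \<Rightarrow> 'a::comm_ring"
  shows "(\<Sum>i = 0..<n. f i * (g (i + 1) - g i)) + (\<Sum>i = 1..n. (f i - f (i - 1)) * g i) =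
    f n * g n - f 0 * g 0"
  by (induction n) (simp_all add: algebra_simps)

lemma step_pos: "a < b \<Longrightarrow> 1 \<le> N \<Longrightarrow> 0 < step a b N"
  by (simp add: step_def)

lemma node_eq_iff:
  assumes "a < b" "1 \<le> N"
  shows "node a b N i = node a b N j \<longleftrightarrow> i = j"
  using step_pos[OF assms] by (simp add: node_def)

lemma node_index_node:
  assumes "a < b" "1 \<le> N" "k \<le> N"
  shows "node_index a b N (node a b N k) = k"
  unfolding node_index_def
  using assms by (intro inv_into_f_f) (auto simp: inj_on_def node_eq_iff)

lemma node_mem_grids:
  assumes "a < b" "1 \<le> N"
  shows "node a b N k \<in> grid a b N \<longleftrightarrow> k \<le> N"
    and "node a b N k \<in> grid_plus a b N \<longleftrightarrow> k < N"
    and "node a b N k \<in> grid_minus a b N \<longleftrightarrow> 1 \<le> k \<and> k \<le> N"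
  by (auto simp: grid_def grid_plus_def grid_minus_def node_eq_iff[OF assms] image_iff)

lemma forward_diff_node:
  assumes "a < b" "1 \<le> N" "k < N"
  shows "forward_diff a b N F (node a b N k) =
    (F (node a b N (k + 1)) - F (node a b N k)) / step a b N"
  using assms by (simp add: forward_diff_def node_mem_grids node_index_node)

lemma backward_diff_node:
  assumes "a < b" "1 \<le> N" "1 \<le> k" "k \<le> N"
  shows "backward_diff a b N F (node a b N k) =
    (F (node a b N k) - F (node a b N (k - 1))) / step a b N"
  using assms by (simp add: backward_diff_def node_mem_grids node_index_node)

lemma forward_integral_last_node:
  assumes "a < b" "1 \<le> N"
  shows "forward_integral a b N F (node a b N N) = (\<Sum>i = 0..<N. step a b N * F (node a b N i))"
  using assms by (simp add: forward_integral_def node_mem_grids node_index_node)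

lemma backward_integral_last_node:
  assumes "a < b" "1 \<le> N"
  shows "backward_integral a b N F (node a b N N) = (\<Sum>i = 1..N. step a b N * F (node a b N i))"
  using assms by (simp add: backward_integral_def node_mem_grids node_index_node)

theorem theorem21:
  fixes a b :: real and N :: nat and F G :: "real \<Rightarrow> real"
  assumes "a < b" and "N \<ge> 1"
    and "F \<in> funs_on (grid a b N)"
    and "G \<in> funs0_on_grid a b N"
  shows "forward_integral a b N
           (star_on (grid_plus a b N) F (forward_diff a b N G)) (node a b N N) =
         - forward_integral a b N
             (star_zero_ext (grid_minus a b N) (grid a b N) (backward_diff a b N F) G)
             (node a b N N) \<and>
         backward_integral a b N
           (star_on (grid_minus a b N) F (backward_diff a b N G)) (node a b N N) =
         - backward_integral a b N
             (star_zero_ext (grid_plus a b N) (grid a b N) (forward_diff a b N F) G)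
             (node a b N N)"
proof -
  note ab = \<open>a < b\<close> \<open>N \<ge> 1\<close>
  define f g where "f i = F (node a b N i)" and "g i = G (node a b N i)" for i
  have g0: "g 0 = 0" and gN: "g N = 0"
    using assms(4) by (simp_all add: funs0_on_grid_def g_def)
  have h: "step a b N \<noteq> 0"
    using step_pos[OF ab] by simp
  have "forward_integral a b N
      (star_on (grid_plus a b N) F (forward_diff a b N G)) (node a b N N) =
    (\<Sum>i = 0..<N. f i * (g (i + 1) - g i))"
    unfolding forward_integral_last_node[OF ab] star_on_def
    using h by (intro sum.cong) (simp_all add: node_mem_grids[OF ab] forward_diff_node[OF ab] f_def g_def)
  moreover have "forward_integral a b N
      (star_zero_ext (grid_minus a b N) (grid a b N) (backward_diff a b N F) G) (node a b N N) =
    (\<Sum>i = 1..N. (f i - f (i - 1)) * g i)"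
    \<comment> \<open>The index \<open>0\<close> contributes nothing by the zero extension, the index \<open>N\<close> because
      \<open>g N = 0\<close>.\<close>
    unfolding forward_integral_last_node[OF ab] star_zero_ext_def
    using h gN
    by (intro sum.mono_neutral_cong)
      (auto simp: node_mem_grids[OF ab] backward_diff_node[OF ab] f_def g_def not_less le_Suc_eq)
  moreover have "backward_integral a b N
      (star_on (grid_minus a b N) F (backward_diff a b N G)) (node a b N N) =
    (\<Sum>i = 1..N. (g i - g (i - 1)) * f i)"
    unfolding backward_integral_last_node[OF ab] star_on_def
    using h by (intro sum.cong) (simp_all add: node_mem_grids[OF ab] backward_diff_node[OF ab] f_def g_def)
  moreover have "backward_integral a b N
      (star_zero_ext (grid_plus a b N) (grid a b N) (forward_diff a b N F) G) (node a b N N) =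
    (\<Sum>i = 0..<N. g i * (f (i + 1) - f i))"
    \<comment> \<open>Here the index \<open>N\<close> contributes nothing by the zero extension, and the index \<open>0\<close>
      because \<open>g 0 = 0\<close>.\<close>
    unfolding backward_integral_last_node[OF ab] star_zero_ext_def
    using h g0
    by (intro sum.mono_neutral_cong)
      (auto simp: node_mem_grids[OF ab] forward_diff_node[OF ab] f_def g_def Suc_le_eq)
  ultimately show ?thesis
    using summation_by_parts[of f g N] summation_by_parts[of g f N] g0 gN
    by (simp add: eq_neg_iff_add_eq_0 add.commute)
qed

end
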